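(* Let $\mathcal{H}$ be a complex Hilbert space and let $T\in\mathcal{B}(\mathcal{H})$. Suppose there exist positive constants $m$ and $M$ and an operator $K\in\mathcal{B}(\mathcal{H})$ with closed range and finite-dimensional kernel such that $$m\|Kx\|^2 \le \frac{1}{N}\sum_{n=0}^{N-1}\|T^nx\|^2 \le M\|x\|^2$$ for every integer $N\ge 1$ and every $x\in\mathcal{H}$, and suppose that every eigenvalue of $T$, if any, has modulus one. Then $T$ is similar to an isometry.
   Context: $\mathcal{B}(\mathcal{H})$ denotes the algebra of bounded linear operators on the Hilbert space $\mathcal{H}$. An operator $T\in\mathcal{B}(\mathcal{H})$ is similar to an isometry if there is an invertible $L\in\mathcal{B}(\mathcal{H})$ such that $L^{-1}TL$ is an isometry of $\mathcal{H}$ (i.e. $\|L^{-1}TLx\|=\|x\|$ for all $x\in\mathcal{H}$; surjectivity is not required). *)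

theory Defs
  imports "HOL-Analysis.Analysis"
begin

class scaleC =
  fixes scaleC :: "complex \<Rightarrow> 'a \<Rightarrow> 'a"  (infixr \<open>*\<^sub>C\<close> 75)

class complex_vector = real_vector + scaleC +
  assumes scaleC_add_right: "a *\<^sub>C (x + y) = a *\<^sub>C x + a *\<^sub>C y"
    and scaleC_add_left: "(a + b) *\<^sub>C x = a *\<^sub>C x + b *\<^sub>C x"
    and scaleC_scaleC: "a *\<^sub>C b *\<^sub>C x = (a * b) *\<^sub>C x"
    and scaleC_one: "1 *\<^sub>C x = x"
    and scaleC_of_real: "complex_of_real r *\<^sub>C x = r *\<^sub>R x"

global_interpretation complex_vector:
  vector_space "scaleC :: complex \<Rightarrow> 'a \<Rightarrow> 'a::complex_vector"
  by unfold_locales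
    (simp_all add: scaleC_add_right scaleC_add_left scaleC_scaleC scaleC_one)

text \<open>
  The complex inner product is linear in its first argument. Its real part is required to be
  the library's real inner product, so that the norm, the distance and the topology are the usual
  ones; positive definiteness of \<open>cinner\<close> then follows, see \<open>cinner_self\<close>.
\<close>

class complex_inner = complex_vector + real_inner +
  fixes cinner :: "'a \<Rightarrow> 'a \<Rightarrow> complex"
  assumes cinner_commute: "cinner x y = cnj (cinner y x)"
    and cinner_add_left: "cinner (x + y) z = cinner x z + cinner y z"
    and cinner_scaleC_left: "cinner (a *\<^sub>C x) y = a * cinner x y"
    and Re_cinner: "Re (cinner x y) = inner x y"

class complex_hilbert_space = complex_inner + complete_space

lemma cinner_self: "cinner x x = complex_of_real ((norm x)\<^sup>2)"
  for x :: "'a::complex_inner"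
proof (rule complex_eqI)
  show "Re (cinner x x) = Re (complex_of_real ((norm x)\<^sup>2))"
    by (simp only: Re_cinner power2_norm_eq_inner Re_complex_of_real)
  have "Im (cinner x x) = - Im (cinner x x)"
    by (metis cinner_commute cnj.sel(2))
  then show "Im (cinner x x) = Im (complex_of_real ((norm x)\<^sup>2))"
    by simp
qed

lemma norm_scaleC: "norm (a *\<^sub>C x) = cmod a * norm x"
  for x :: "'a::complex_inner"
proof -
  have "cinner (a *\<^sub>C x) (a *\<^sub>C x) = (a * cnj a) * cinner x x"
    by (metis (no_types, lifting) cinner_commute cinner_scaleC_left complex_cnj_mult
        mult.assoc)
  then have "complex_of_real ((norm (a *\<^sub>C x))\<^sup>2)
      = complex_of_real ((cmod a * norm x)\<^sup>2)"
    by (simp add: cinner_self power_mult_distrib flip: complex_norm_square)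
  then have "(norm (a *\<^sub>C x))\<^sup>2 = (cmod a * norm x)\<^sup>2"
    by (simp only: of_real_eq_iff)
  then show ?thesis
    by (rule power2_eq_imp_eq) simp_all
qed

instantiation complex :: complex_hilbert_space
begin

definition scaleC_complex :: "complex \<Rightarrow> complex \<Rightarrow> complex"
  where "scaleC_complex a x = a * x"

definition cinner_complex :: "complex \<Rightarrow> complex \<Rightarrow> complex"
  where "cinner_complex x y = x * cnj y"

instance
  by standard
    (simp_all add: scaleC_complex_def cinner_complex_def algebra_simps scaleR_conv_of_real
      inner_complex_def)

end

definition bounded_clinear :: "('a::complex_inner \<Rightarrow> 'b::complex_inner) \<Rightarrow> bool"
  where "bounded_clinear f \<longleftrightarrow> bounded_linear f \<and> (\<forall>c x. f (c *\<^sub>C x) = c *\<^sub>C f x)"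

definition op_kernel :: "('a::zero \<Rightarrow> 'b::zero) \<Rightarrow> 'a set"
  where "op_kernel f = {x. f x = 0}"

definition finite_cdim :: "'a::complex_vector set \<Rightarrow> bool"
  where "finite_cdim S \<longleftrightarrow> (\<exists>B. finite B \<and> complex_vector.span B = S)"

definition eigenvalue :: "('a::complex_vector \<Rightarrow> 'a) \<Rightarrow> complex \<Rightarrow> bool"
  where "eigenvalue T \<mu> \<longleftrightarrow> (\<exists>v. v \<noteq> 0 \<and> T v = \<mu> *\<^sub>C v)"

definition similar_to_isometry :: "('a::complex_inner \<Rightarrow> 'a) \<Rightarrow> bool"
  where "similar_to_isometry T \<longleftrightarrow>
    (\<exists>(L::'a \<Rightarrow> 'a) (L'::'a \<Rightarrow> 'a). bounded_clinear L \<and> bounded_clinear L' \<and> L \<circ> L' = id \<and>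
       L' \<circ> L = id \<and>
       (\<forall>x. norm ((L' \<circ> T \<circ> L) x) = norm x))"

end

theory Submission
  imports Defs "HOL-Computational_Algebra.Fundamental_Theorem_Algebra"
begin

text \<open>
  A pointwise cluster point of the twice averaged forms \<open>\<langle>T\<^sup>n x, T\<^sup>n y\<rangle>\<close> is a bounded semi-inner product
  \<open>b\<close> for which \<open>T\<close> is isometric; the hypotheses give \<open>m \<parallel>K x\<parallel>\<^sup>2 \<le> b x x \<le> M \<parallel>x\<parallel>\<^sup>2\<close>. Its null space is
  \<open>T\<close>-invariant and contained in the finite-dimensional kernel of \<open>K\<close>, so if it were nonzero it would
  contain an eigenvector \<open>w\<close>; its eigenvalue has modulus one, hence \<open>b w w = \<parallel>w\<parallel>\<^sup>2 \<noteq> 0\<close>, a contradiction.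
  A definite form that dominates \<open>\<parallel>K x\<parallel>\<^sup>2\<close> is coercive, because \<open>K\<close> has closed range and
  finite-dimensional kernel. So \<open>b x y = \<langle>S x, y\<rangle>\<close> with \<open>S\<close> positive and invertible, and \<open>S\<close> to the
  power \<open>1/2\<close> conjugates \<open>T\<close> to an isometry.
\<close>

subsection \<open>Complex scalars and complex span\<close>

lemma cinner_scaleC_right: "cinner x (c *\<^sub>C y) = cnj c * cinner x y"
  for x y :: "'a::complex_inner"
  by (simp add: cinner_commute[of x "c *\<^sub>C y"] cinner_commute[of x y] cinner_scaleC_left)

text \<open>For the real inner product, multiplication by \<open>cnj c\<close> is the adjoint of
  multiplication by \<open>c\<close>. The real forms used below carry this same compatibility in
  place of complex sesquilinearity.\<close>

lemma inner_scaleC_left: "inner (c *\<^sub>C x) y = inner x (cnj c *\<^sub>C y)"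
  for x y :: "'a::complex_inner"
  by (simp flip: Re_cinner add: cinner_scaleC_left cinner_scaleC_right)

lemma bounded_linear_scaleC: "bounded_linear (\<lambda>x :: 'a::complex_inner. c *\<^sub>C x)"
proof (rule bounded_linear_intro[of _ "cmod c"])
  show "c *\<^sub>C r *\<^sub>R x = r *\<^sub>R c *\<^sub>C x" for r and x :: 'a
    by (simp add: scaleC_scaleC mult.commute flip: scaleC_of_real)
qed (auto simp: scaleC_add_right norm_scaleC mult.commute)

text \<open>Multiplication by the imaginary unit preserves the real span on the right, because
  applying it twice only changes the sign. This transfers complex finite dimension to real spans,
  where the compactness argument takes place.\<close>

lemma complex_span_eq_span:
  "complex_vector.span B = span (B \<union> (\<lambda>x. \<i> *\<^sub>C x) ` B)"
  for B :: "'a::complex_vector set"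
proof
  show "span (B \<union> (\<lambda>x. \<i> *\<^sub>C x) ` B) \<subseteq> complex_vector.span B"
  proof (rule span_minimal)
    show "subspace (complex_vector.span B)"
      unfolding subspace_def scaleC_of_real[symmetric]
      by (auto intro: complex_vector.span_zero complex_vector.span_add complex_vector.span_scale)
  qed (auto intro: complex_vector.span_base complex_vector.span_scale)
  let ?S = "span (B \<union> (\<lambda>x. \<i> *\<^sub>C x) ` B)"
  have cx: "c *\<^sub>C x = Re c *\<^sub>R x + Im c *\<^sub>R (\<i> *\<^sub>C x)" for c and x :: 'a
    by (subst complex_eq[of c]) (simp add: scaleC_add_left scaleC_scaleC mult.commute flip: scaleC_of_real)
  have i: "\<i> *\<^sub>C x \<in> ?S" if "x \<in> ?S" for x
    using that
  proof (induction x rule: span_induct_alt)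
    case base
    then show ?case by (simp add: span_zero)
  next
    case (step r x y)
    have "\<i> *\<^sub>C x \<in> ?S"
    proof (cases "x \<in> B")
      case False
      then obtain z where z: "z \<in> B" "x = \<i> *\<^sub>C z" using step.hyps by blast
      have "\<i> *\<^sub>C x = (- 1) *\<^sub>R z"
        unfolding z(2) by (simp add: scaleC_scaleC flip: scaleC_of_real)
      then show ?thesis using z(1) by (simp only:) (intro span_scale span_base, blast)
    qed (intro span_base, blast)
    moreover have "\<i> *\<^sub>C (r *\<^sub>R x + y) = r *\<^sub>R (\<i> *\<^sub>C x) + \<i> *\<^sub>C y"
      by (simp add: scaleC_add_right scaleC_scaleC mult.commute flip: scaleC_of_real)
    ultimately show ?case
      using step.IH by (simp only:) (intro span_add span_scale)
  qed
  show "complex_vector.span B \<subseteq> ?S"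
  proof (rule complex_vector.span_minimal)
    have "c *\<^sub>C x \<in> ?S" if "x \<in> ?S" for c x
      unfolding cx[of c x] by (intro span_add span_scale i that)
    then show "complex_vector.subspace ?S"
      unfolding complex_vector.subspace_def by (auto intro: span_zero span_add)
  qed (auto intro: span_base)
qed

section \<open>Compactness of balls in finitely generated subspaces\<close>

lemma closed_if_compact_balls:
  fixes S :: "'a::real_normed_vector set"
  assumes "\<And>r. compact (S \<inter> cball 0 r)"
  shows "closed S"
  unfolding closed_sequential_limits
proof (intro allI impI, elim conjE)
  fix x l assume x: "\<forall>n. x n \<in> S" "x \<longlonglongrightarrow> l"
  have "bounded (range x)"
    using x(2) by (rule convergent_imp_bounded)
  then obtain r where r: "\<And>n. norm (x n) \<le> r"
    unfolding bounded_iff by blast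
  have "l \<in> S \<inter> cball 0 r"
    by (rule closed_sequentially[OF compact_imp_closed[OF assms] _ x(2)]) (use x(1) r in auto)
  then show "l \<in> S" by blast
qed

text \<open>Induction on the generators. A new generator \<open>e\<close> outside
  \<open>span B\<close> has positive distance \<open>d\<close> from this closed subspace, so the
  coefficient of \<open>e\<close> in a vector of norm at most \<open>r\<close> is at most
  \<open>r / d\<close> in absolute value. The ball is therefore cut out of a continuous image of a
  compact product.\<close>

lemma compact_span_Int_cball:
  fixes B :: "'a::real_normed_vector set"
  assumes "finite B"
  shows "compact (span B \<inter> cball 0 r)"
  using assms
proof (induction B arbitrary: r rule: finite_induct)
  case empty
  have "span {} \<inter> cball 0 r = (if r \<ge> 0 then {0::'a} else {})"
    by auto
  then show ?case by simp
next
  case (insert e B)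
  \<comment> \<open>The induction hypothesis is available for every radius, which is what closedness
    requires.\<close>
  have cl: "closed (span B)"
    by (rule closed_if_compact_balls) (use insert.IH in auto)
  show ?case
  proof (cases "e \<in> span B")
    case True
    then show ?thesis using insert.IH by (simp add: span_redundant)
  next
    case False
    define d where "d = infdist e (span B)"
    have ne: "span B \<noteq> {}" using span_zero by blast
    have d: "d > 0"
      using in_closed_iff_infdist_zero[OF cl ne, of e] False infdist_nonneg[of e "span B"]
      by (simp add: d_def)
    have dist: "\<bar>t\<bar> * d \<le> norm (t *\<^sub>R e + v)" if v: "v \<in> span B" for t v
    proof (cases "t = 0")
      case False
      have "- (inverse t *\<^sub>R v) \<in> span B"
        using v by (intro span_neg span_scale)
      then have "d \<le> dist e (- (inverse t *\<^sub>R v))"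
        unfolding d_def by (rule infdist_le)
      then have "\<bar>t\<bar> * d \<le> \<bar>t\<bar> * norm (e + inverse t *\<^sub>R v)"
        by (intro mult_left_mono) (auto simp: dist_norm)
      also have "\<dots> = norm (t *\<^sub>R (e + inverse t *\<^sub>R v))"
        by simp
      also have "t *\<^sub>R (e + inverse t *\<^sub>R v) = t *\<^sub>R e + v"
        using False by (simp add: scaleR_right_distrib)
      finally show ?thesis .
    qed simp
    define P where "P = {- (r / d)..r / d} \<times> (span B \<inter> cball 0 (r + r / d * norm e))"
    define h where "h = (\<lambda>(t, v). t *\<^sub>R e + v)"
    have "compact (h ` P)"
    proof (rule compact_continuous_image)
      show "continuous_on P h"
        unfolding h_def case_prod_unfold by (intro continuous_intros)
      show "compact P"
        unfolding P_def using insert.IH by (intro compact_Times) auto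
    qed
    moreover have "span (insert e B) \<inter> cball 0 r = h ` P \<inter> cball 0 r"
    proof (intro equalityI subsetI)
      fix x assume x: "x \<in> span (insert e B) \<inter> cball 0 r"
      then obtain t where t: "x - t *\<^sub>R e \<in> span B"
        by (auto simp: span_insert)
      have "\<bar>t\<bar> * d \<le> norm x"
        using dist[OF t, of t] by simp
      then have "\<bar>t\<bar> * d \<le> r" using x by simp
      then have tr: "\<bar>t\<bar> \<le> r / d"
        using d by (simp add: field_simps)
      have "norm (x - t *\<^sub>R e) \<le> norm x + \<bar>t\<bar> * norm e"
        by (metis norm_scaleR norm_triangle_ineq4)
      also have "\<dots> \<le> r + r / d * norm e"
        using x tr by (intro add_mono mult_right_mono) auto
      finally have "(t, x - t *\<^sub>R e) \<in> P"
        using t tr by (auto simp: P_def)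
      then have "h (t, x - t *\<^sub>R e) \<in> h ` P" by (rule imageI)
      then show "x \<in> h ` P \<inter> cball 0 r"
        using x by (simp add: h_def)
    next
      fix x assume x: "x \<in> h ` P \<inter> cball 0 r"
      then obtain t v where "v \<in> span B" "x = t *\<^sub>R e + v"
        by (auto simp: h_def P_def)
      then have "x \<in> span (insert e B)"
        by (auto simp: span_insert intro!: exI[of _ t])
      then show "x \<in> span (insert e B) \<inter> cball 0 r" using x by simp
    qed
    ultimately show ?thesis
      by (simp add: compact_Int_closed)
  qed
qed

lemma finite_cdim_compact_Int_cball:
  fixes S :: "'a::complex_inner set"
  assumes "finite_cdim S"
  shows "compact (S \<inter> cball 0 r)"
  using assms unfolding finite_cdim_def
  by (metis complex_span_eq_span compact_span_Int_cball finite_UnI finite_imageI)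

subsection \<open>Eigenvectors in finite-dimensional invariant subspaces\<close>

text \<open>The vector p(T) v, computed by Horner's scheme. Folding over the coefficients requires
  no ring structure on the operators.\<close>

definition op_poly :: "('a::complex_vector \<Rightarrow> 'a) \<Rightarrow> complex poly \<Rightarrow> 'a \<Rightarrow> 'a"
  where "op_poly T p v = fold_coeffs (\<lambda>c w. c *\<^sub>C v + T w) p 0"

lemma op_poly_0 [simp]: "op_poly T 0 v = 0"
  by (simp add: op_poly_def)

text \<open>The hypothesis \<open>T 0 = 0\<close> serves the case \<open>pCons 0 0\<close>, whose
  coefficient list is empty.\<close>

lemma op_poly_pCons [simp]:
  assumes "T 0 = 0"
  shows "op_poly T (pCons c p) v = c *\<^sub>C v + T (op_poly T p v)"
  using assms by (cases "p = 0 \<and> c = 0") (auto simp: op_poly_def)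

context
  fixes T :: "'a::complex_vector \<Rightarrow> 'a"
  assumes add: "\<And>x y. T (x + y) = T x + T y" and scale: "\<And>c x. T (c *\<^sub>C x) = c *\<^sub>C T x"
begin

lemma clinear_map_zero [simp]: "T 0 = 0"
  using scale[of 0 0] by simp

lemma op_poly_add: "op_poly T (p + q) v = op_poly T p v + op_poly T q v"
  by (induction p q rule: poly_induct2) (simp_all add: add scaleC_add_left)

lemma op_poly_smult: "op_poly T (smult c p) v = c *\<^sub>C op_poly T p v"
  by (induction p) (simp_all add: scale scaleC_add_right scaleC_scaleC)

lemma op_poly_linear_factor:
  "op_poly T ([:- a, 1:] * q) v = T (op_poly T q v) - a *\<^sub>C op_poly T q v"
proof -
  have "[:- a, 1:] * q = smult (- a) q + pCons 0 q"
    by simp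
  then show ?thesis
    by (simp only: op_poly_add op_poly_smult) (simp add: complex_vector.scale_minus_left)
qed

lemma op_poly_monom: "op_poly T (monom c n) v = c *\<^sub>C (T ^^ n) v"
  by (induction n) (simp_all add: monom_0 monom_Suc scale)

lemma op_poly_sum: "op_poly T (sum f A) v = (\<Sum>i\<in>A. op_poly T (f i) v)"
  by (induction A rule: infinite_finite_induct) (simp_all add: op_poly_add)

text \<open>The first \<open>card B + 1\<close> vectors of the orbit of \<open>v\<close> lie in a
  space spanned by \<open>card B\<close> vectors, and the coefficients of a linear relation between
  them are those of the polynomial.\<close>

lemma exists_annihilating_poly:
  assumes B: "finite B" and v: "\<And>n. (T ^^ n) v \<in> complex_vector.span B"
  shows "\<exists>p. p \<noteq> 0 \<and> op_poly T p v = 0"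
\<comment> \<open>Dependence is a property of sets, so a repetition in the orbit is treated apart:
  it yields the polynomial X^i - X^j.\<close>
proof (cases "inj_on (\<lambda>n. (T ^^ n) v) {..card B}")
  case True
  let ?S = "(\<lambda>n. (T ^^ n) v) ` {..card B}"
  have "card ?S = Suc (card B)"
    using card_image[OF True] by simp
  then have "complex_vector.dependent ?S"
    using complex_vector.independent_span_bound[OF B, of ?S] v by fastforce
  then obtain u where u: "\<exists>w\<in>?S. u w \<noteq> 0" "(\<Sum>w\<in>?S. u w *\<^sub>C w) = 0"
    using complex_vector.dependent_finite[of ?S] by auto
  define c where "c n = u ((T ^^ n) v)" for n
  define p where "p = (\<Sum>n\<le>card B. monom (c n) n)"
  have "op_poly T p v = (\<Sum>n\<le>card B. c n *\<^sub>C (T ^^ n) v)"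
    by (simp add: p_def op_poly_sum op_poly_monom)
  also have "\<dots> = 0"
    using u(2) by (simp add: sum.reindex[OF True] c_def)
  finally have "op_poly T p v = 0" .
  moreover obtain k where "k \<le> card B" "c k \<noteq> 0"
    using u(1) by (auto simp: c_def)
  then have "coeff p k \<noteq> 0"
    by (simp add: p_def coeff_sum)
  then have "p \<noteq> 0" by auto
  ultimately show ?thesis by blast
next
  case False
  then obtain i j where ij: "i \<noteq> j" "(T ^^ i) v = (T ^^ j) v"
    by (auto simp: inj_on_def)
  define p where "p = monom 1 i + monom (- 1 :: complex) j"
  have "op_poly T p v = 0"
    using ij(2) by (simp add: p_def op_poly_add op_poly_monom complex_vector.scale_minus_left)
  moreover have "coeff p i = 1"
    using ij(1) by (simp add: p_def)
  then have "p \<noteq> 0" by auto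
  ultimately show ?thesis by blast
qed

text \<open>An annihilating polynomial of least degree is nonconstant, so it has a root
  \<open>a\<close> and a factorization (X - a) q. By minimality q(T) v is nonzero, and T - a kills
  it. The eigenvector is given as a polynomial in \<open>T\<close> applied to \<open>v\<close> so
  that it visibly stays in every \<open>T\<close>-invariant subspace containing
  \<open>v\<close>.\<close>

lemma exists_eigenvector_op_poly:
  assumes "finite B" and "\<And>n. (T ^^ n) v \<in> complex_vector.span B" and "v \<noteq> 0"
  obtains a q where "op_poly T q v \<noteq> 0" "T (op_poly T q v) = a *\<^sub>C op_poly T q v"
proof -
  have "\<exists>p. (p \<noteq> 0 \<and> op_poly T p v = 0) \<and>
      (\<forall>q. q \<noteq> 0 \<and> op_poly T q v = 0 \<longrightarrow> degree p \<le> degree q)"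
    using exists_annihilating_poly[OF assms(1,2)]
      ex_has_least_nat[of "\<lambda>p. p \<noteq> 0 \<and> op_poly T p v = 0" _ degree] by blast
  then obtain p where p: "p \<noteq> 0" "op_poly T p v = 0"
    and least: "\<And>q. q \<noteq> 0 \<Longrightarrow> op_poly T q v = 0 \<Longrightarrow> degree p \<le> degree q"
    by blast
  have "degree p > 0"
  proof (rule ccontr)
    assume "\<not> degree p > 0"
    then obtain c where "p = [:c:]" by (auto elim: degree_eq_zeroE)
    then show False
      using p assms(3) by (simp add: complex_vector.scale_eq_0_iff)
  qed
  then obtain a where "poly p a = 0"
    using alg_closed_imp_poly_has_root by blast
  then obtain q where q: "p = [:- a, 1:] * q"
    by (auto simp: poly_eq_0_iff_dvd dvd_def)
  have q0: "q \<noteq> 0" using p q by auto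
  have "degree p = Suc (degree q)"
    unfolding q using q0 by (subst degree_mult_eq) auto
  then have "op_poly T q v \<noteq> 0"
    using least[OF q0] by fastforce
  moreover have "T (op_poly T q v) = a *\<^sub>C op_poly T q v"
    using p(2) unfolding q op_poly_linear_factor by simp
  ultimately show thesis by (rule that)
qed

end

subsection \<open>Bounded forms and the square root of a positive operator\<close>

text \<open>The representing vector is the minimizer of the functional \<open>J\<close>, whose
  derivative at \<open>z\<close> in direction \<open>x\<close> is 2 (inner z x - f x).\<close>

lemma Riesz_representation:
  fixes f :: "'a::{real_inner,complete_space} \<Rightarrow> real"
  assumes "bounded_linear f"
  obtains z where "\<And>x. f x = inner z x"
proof -
  interpret f: bounded_linear f by fact
  define J where "J x = (norm x)\<^sup>2 - 2 * f x" for x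
  obtain C where C: "\<And>x. norm (f x) \<le> norm x * C" using f.bounded by blast
  have "- (C\<^sup>2) \<le> J x" for x
  proof -
    have "f x \<le> norm x * C" using C[of x] by simp
    moreover have "0 \<le> (norm x - C)\<^sup>2" by simp
    ultimately show ?thesis by (simp add: J_def power2_diff)
  qed
  then have bdd: "bdd_below (range J)" by (intro bdd_belowI) blast
  define d where "d = Inf (range J)"
  have dJ: "d \<le> J x" for x unfolding d_def by (intro cInf_lower bdd) auto
  have "\<exists>x. J x < d + inverse (real (Suc n))" for n
  proof -
    have "d < d + inverse (real (Suc n))" by simp
    then show ?thesis unfolding d_def using cInf_lessD[of "range J"] by blast
  qed
  then obtain X where X: "\<And>n. J (X n) < d + inverse (real (Suc n))" by metis
  \<comment> \<open>The parallelogram law, in which the linear terms cancel. Since \<open>J\<close>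
    is at least \<open>d\<close> at the midpoint, almost minimal points are close together.\<close>
  have para: "(norm (x - y))\<^sup>2 = 2 * J x + 2 * J y - 4 * J ((1 / 2) *\<^sub>R (x + y))" for x y
    by (simp add: J_def f.scaleR f.add power_mult_distrib power2_norm_eq_inner inner_commute algebra_simps)
  have "Cauchy X"
  proof (rule metric_CauchyI)
    fix e :: real assume e: "e > 0"
    then obtain N where N: "inverse (real (Suc N)) < e\<^sup>2 / 4"
      using reals_Archimedean[of "e\<^sup>2 / 4"] by auto
    have "dist (X m) (X n) < e" if mn: "m \<ge> N" "n \<ge> N" for m n
    proof -
      have "inverse (real (Suc m)) \<le> inverse (real (Suc N))"
        "inverse (real (Suc n)) \<le> inverse (real (Suc N))"
        using mn by (auto intro!: le_imp_inverse_le)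
      then have "(norm (X m - X n))\<^sup>2 < e\<^sup>2"
        using para[of "X m" "X n"] X[of m] X[of n] dJ[of "(1 / 2) *\<^sub>R (X m + X n)"] N by linarith
      then show ?thesis using e by (simp add: dist_norm power_less_imp_less_base)
    qed
    then show "\<exists>N. \<forall>m\<ge>N. \<forall>n\<ge>N. dist (X m) (X n) < e" by blast
  qed
  then obtain z where z: "X \<longlonglongrightarrow> z"
    using Cauchy_convergent_iff convergent_def by blast
  have "(\<lambda>n. J (X n)) \<longlonglongrightarrow> J z"
    unfolding J_def by (intro tendsto_intros f.tendsto z)
  moreover have "(\<lambda>n. d + inverse (real (Suc n))) \<longlonglongrightarrow> d + 0"
    by (intro tendsto_intros LIMSEQ_inverse_real_of_nat)
  ultimately have "J z \<le> d"
    using X by (intro LIMSEQ_le[of "\<lambda>n. J (X n)" "J z" "\<lambda>n. d + inverse (real (Suc n))"])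
      (auto intro: less_imp_le)
  then have min: "J z \<le> J y" for y using dJ order_trans by blast
  have "f x = inner z x" for x
  proof (rule ccontr)
    assume ne: "f x \<noteq> inner z x"
    define a where "a = f x - inner z x"
    \<comment> \<open>Minimality along the line through \<open>z\<close> in direction
      \<open>x\<close>. The choice t = a / |x|^2 below makes the right-hand side negative unless
      \<open>a = 0\<close>.\<close>
    have q: "0 \<le> t\<^sup>2 * (norm x)\<^sup>2 - 2 * t * a" for t
    proof -
      have "J (z + t *\<^sub>R x) = J z + (t\<^sup>2 * (norm x)\<^sup>2 - 2 * t * a)"
        unfolding J_def a_def power2_norm_eq_inner
        by (simp add: f.add f.scaleR inner_simps inner_commute power2_eq_square algebra_simps)
      then show ?thesis using min[of "z + t *\<^sub>R x"] by simp
    qed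
    have "x \<noteq> 0" using ne by (auto simp: f.zero)
    then have "0 \<le> - (a\<^sup>2 / (norm x)\<^sup>2)"
      using q[of "a / (norm x)\<^sup>2"] by (simp add: power2_eq_square field_simps)
    then show False using ne \<open>x \<noteq> 0\<close> by (simp add: a_def divide_le_0_iff)
  qed
  then show thesis using that by blast
qed

text \<open>The usual discriminant argument, with the case \<open>b y y = 0\<close> treated apart:
  the lemma is applied to the limit form before that form is known to be definite.\<close>

lemma form_Cauchy_Schwarz:
  fixes b :: "'a::real_vector \<Rightarrow> 'a \<Rightarrow> real"
  assumes lin: "\<And>y. linear (\<lambda>x. b x y)" and sym: "\<And>x y. b x y = b y x"
    and nonneg: "\<And>x. 0 \<le> b x x"
  shows "(b x y)\<^sup>2 \<le> b x x * b y y"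
proof -
  have q: "0 \<le> b x x + 2 * t * b x y + t\<^sup>2 * b y y" for t
  proof -
    have add: "b (u + v) w = b u w + b v w" and sc: "b (s *\<^sub>R u) w = s * b u w" for u v w s
      using linear_add[OF lin] linear_cmul[OF lin] by auto
    have add': "b w (u + v) = b w u + b w v" and sc': "b w (s *\<^sub>R u) = s * b w u" for u v w s
      using add sc sym by metis+
    have "b (x + t *\<^sub>R y) (x + t *\<^sub>R y) = b x x + 2 * t * b x y + t\<^sup>2 * b y y"
      by (simp add: add sc add' sc' sym[of y x] power2_eq_square algebra_simps)
    then show ?thesis using nonneg[of "x + t *\<^sub>R y"] by simp
  qed
  show ?thesis
  proof (cases "b y y = 0")
    case True
    have "b x y = 0"
    proof (rule ccontr)
      assume "b x y \<noteq> 0"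
      \<comment> \<open>At this \<open>t\<close> the affine function in \<open>q\<close> takes the
        value -1.\<close>
      then show False
        using q[of "- (b x x + 1) / (2 * b x y)"] True by (simp add: field_simps)
    qed
    then show ?thesis using True by simp
  next
    case False
    then have "b y y > 0" using nonneg[of y] by simp
    then show ?thesis using q[of "- b x y / b y y"]
      by (simp add: power2_eq_square field_simps)
  qed
qed

text \<open>By Cauchy-Schwarz the bound \<open>q\<close> on the diagonal of a nonnegative form
  bounds all its values, so the Riesz vector of \<open>b x\<close> has norm at most
  \<open>q * norm x\<close>. Uniqueness of this vector makes it depend linearly on
  \<open>x\<close>.\<close>

lemma form_operator:
  fixes b :: "'a::{real_inner,complete_space} \<Rightarrow> 'a \<Rightarrow> real"
  assumes lin: "\<And>y. linear (\<lambda>x. b x y)" and sym: "\<And>x y. b x y = b y x"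
    and nonneg: "\<And>x. 0 \<le> b x x" and le: "\<And>x. b x x \<le> q * (norm x)\<^sup>2" and q: "q \<ge> 0"
  obtains R :: "'a \<Rightarrow>\<^sub>L 'a" where "norm R \<le> q" "\<And>x y. inner (R x) y = b x y"
proof -
  have bd: "\<bar>b x y\<bar> \<le> q * norm x * norm y" for x y
  proof -
    have "(b x y)\<^sup>2 \<le> b x x * b y y"
      by (rule form_Cauchy_Schwarz[OF lin sym nonneg])
    also have "\<dots> \<le> (q * (norm x)\<^sup>2) * (q * (norm y)\<^sup>2)"
      by (intro mult_mono le nonneg) (use q in auto)
    finally have "(b x y)\<^sup>2 \<le> (q * norm x * norm y)\<^sup>2"
      by (simp add: power2_eq_square algebra_simps)
    moreover have "0 \<le> q * norm x * norm y" using q by simp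
    ultimately show "\<bar>b x y\<bar> \<le> q * norm x * norm y"
      by (metis abs_le_square_iff abs_of_nonneg)
  qed
  have "bounded_linear (b x)" for x
  proof -
    have "linear (b x)" using lin[of x] sym by (metis (no_types, lifting) ext)
    then show ?thesis
      by (intro bounded_linear_intro[of _ "q * norm x"])
        (use bd[of x] in \<open>auto simp: linear_add linear_cmul mult.commute\<close>)
  qed
  then have "\<exists>z. \<forall>y. b x y = inner z y" for x
    by (metis Riesz_representation)
  then obtain g where g: "\<And>x y. b x y = inner (g x) y" by metis
  have ng: "norm (g x) \<le> q * norm x" for x
  proof (cases "g x = 0")
    case False
    have "norm (g x) * norm (g x) \<le> (q * norm x) * norm (g x)"
      using bd[of x "g x"] g[of x "g x"] by (simp add: power2_norm_eq_inner[symmetric] power2_eq_square)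
    then show ?thesis using False by simp
  qed (use q in simp)
  have "bounded_linear g"
  proof (rule bounded_linear_intro[of _ q])
    show "g (x + y) = g x + g y" for x y
    proof -
      have "inner (g (x + y)) z = inner (g x + g y) z" for z
        using linear_add[OF lin[of z], of x y] by (simp add: g inner_add_left)
      then show ?thesis using vector_eq_rdot by blast
    qed
    show "g (r *\<^sub>R x) = r *\<^sub>R g x" for r x
    proof -
      have "inner (g (r *\<^sub>R x)) z = inner (r *\<^sub>R g x) z" for z
        using linear_cmul[OF lin[of z], of r x] by (simp add: g)
      then show ?thesis using vector_eq_rdot by blast
    qed
  qed (use ng in \<open>auto simp: mult.commute\<close>)
  then have "blinfun_apply (Blinfun g) = g" by (rule bounded_linear_Blinfun_apply)
  then show thesis
    using that[of "Blinfun g"] g ng q by (simp add: norm_blinfun_bound)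
qed

text \<open>The fixed point equation \<open>2 Y = R + Y\<^sup>2\<close> says that \<open>1 - Y\<close> is a square root of \<open>1 - R\<close>.\<close>

lemma selfadjoint_sqrt_fixpoint:
  fixes R :: "'a::{real_inner,banach} \<Rightarrow>\<^sub>L 'a"
  assumes R: "norm R \<le> q" and q: "q < 1"
    and sym: "\<And>x y. inner (R x) y = inner x (R y)"
    and J: "\<And>i. bounded_linear (J i)"
    and comm: "\<And>i x. R (J i x) = J i (R x)"
  obtains Y :: "'a \<Rightarrow>\<^sub>L 'a" where "norm Y \<le> q"
    "\<And>x y. inner (Y x) y = inner x (Y y)"
    "\<And>i x. Y (J i x) = J i (Y x)"
    "\<And>x. 2 *\<^sub>R Y x = R x + Y (Y x)"
proof -
  have q0: "q \<ge> 0" using R norm_ge_zero order_trans by blast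
  \<comment> \<open>Self-adjointness and commutation with every \<open>J i\<close> are closed
    conditions preserved by \<open>\<Phi>\<close>. Building them into the complete set
    \<open>S\<close> passes them on to the fixed point.\<close>
  define S where "S = cball 0 q \<inter> {Y :: 'a \<Rightarrow>\<^sub>L 'a. \<forall>x y. inner (Y x) y = inner x (Y y)}
    \<inter> {Y :: 'a \<Rightarrow>\<^sub>L 'a. \<forall>i x. Y (J i x) = J i (Y x)}"
  define \<Phi> where "\<Phi> Y = (1 / 2) *\<^sub>R (R + (Y o\<^sub>L Y))" for Y :: "'a \<Rightarrow>\<^sub>L 'a"
  have "continuous_on UNIV (\<lambda>Y :: 'a \<Rightarrow>\<^sub>L 'a. J i (Y x))" for i x
    by (rule bounded_linear.continuous_on[OF J]) (intro continuous_intros)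
  then have "closed S"
    unfolding S_def
    by (intro closed_Int closed_cball closed_Collect_all closed_Collect_eq
        continuous_intros)
  then have "complete S" by (simp add: complete_eq_closed)
  moreover have "S \<noteq> {}"
  proof -
    have "J i 0 = 0" for i using J by (simp add: linear_simps)
    then have "0 \<in> S" using q0 by (simp add: S_def)
    then show ?thesis by blast
  qed
  moreover have "\<Phi> ` S \<subseteq> S"
  proof
    fix Z assume "Z \<in> \<Phi> ` S"
    then obtain Y where Y: "Y \<in> S" and Z: "Z = \<Phi> Y" by blast
    have nY: "norm Y \<le> q" using Y by (simp add: S_def)
    have "norm Z \<le> 1 / 2 * (norm R + norm (Y o\<^sub>L Y))"
      unfolding Z \<Phi>_def by (simp add: norm_triangle_ineq)
    also have "\<dots> \<le> 1 / 2 * (q + q * 1)"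
      using norm_blinfun_compose[of Y Y] mult_mono[OF nY nY q0] q q0 R
        mult_left_mono[of q 1 q] by simp
    finally have "norm Z \<le> q" by simp
    moreover have "inner (Z x) y = inner x (Z y)" for x y
      using Y sym by (simp add: Z \<Phi>_def S_def blinfun.bilinear_simps inner_simps)
    moreover have "Z (J i x) = J i (Z x)" for i x
      using Y comm linear_simps[OF J]
      by (simp add: Z \<Phi>_def S_def blinfun.bilinear_simps)
    ultimately show "Z \<in> S" by (simp add: S_def)
  qed
  moreover have "\<forall>Y\<in>S. \<forall>Z\<in>S. dist (\<Phi> Y) (\<Phi> Z) \<le> q * dist Y Z"
  proof (intro ballI)
    fix Y Z assume "Y \<in> S" "Z \<in> S"
    then have n: "norm Y \<le> q" "norm Z \<le> q" by (auto simp: S_def)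
    \<comment> \<open>The noncommutative form of Y^2 - Z^2 = Y (Y - Z) + (Y - Z) Z. The factor 1/2
      then leaves the contraction constant \<open>q\<close>.\<close>
    have "\<Phi> Y - \<Phi> Z = (1 / 2) *\<^sub>R ((Y o\<^sub>L (Y - Z)) + ((Y - Z) o\<^sub>L Z))"
      by (rule blinfun_eqI)
        (simp add: \<Phi>_def blinfun.bilinear_simps scaleR_right_diff_distrib[symmetric])
    then have "dist (\<Phi> Y) (\<Phi> Z) = 1 / 2 * norm ((Y o\<^sub>L (Y - Z)) + ((Y - Z) o\<^sub>L Z))"
      by (simp add: dist_norm)
    also have "\<dots> \<le> 1 / 2 * (norm Y * norm (Y - Z) + norm (Y - Z) * norm Z)"
      by (intro mult_left_mono norm_triangle_mono norm_blinfun_compose) simp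
    also have "\<dots> \<le> 1 / 2 * (q * norm (Y - Z) + norm (Y - Z) * q)"
      using n by (intro mult_left_mono add_mono mult_right_mono) auto
    finally show "dist (\<Phi> Y) (\<Phi> Z) \<le> q * dist Y Z"
      by (simp add: dist_norm algebra_simps)
  qed
  ultimately obtain Y where Y: "Y \<in> S" "\<Phi> Y = Y"
    using Banach_fix[of S q \<Phi>] q0 q by metis
  have "2 *\<^sub>R Y x = R x + Y (Y x)" for x
  proof -
    have "2 *\<^sub>R (\<Phi> Y) x = R x + Y (Y x)"
      by (simp add: \<Phi>_def blinfun.bilinear_simps)
    then show ?thesis by (simp add: Y(2))
  qed
  with Y(1) show thesis by (intro that[of Y]) (auto simp: S_def)
qed

text \<open>Injectivity follows from the lower bound, which later also bounds the inverse. A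
  preimage of \<open>y\<close> is the fixed point of the contraction x -> y + Y x.\<close>

lemma bij_diff_contraction:
  fixes Y :: "'a::banach \<Rightarrow>\<^sub>L 'a"
  assumes "norm Y < 1"
  shows "bij (\<lambda>x. x - Y x)" and "norm (x - Y x) \<ge> (1 - norm Y) * norm x"
proof -
  have lb: "norm (x - Y x) \<ge> (1 - norm Y) * norm x" for x
    using norm_blinfun[of Y x] norm_triangle_ineq2[of x "Y x"] by (simp add: algebra_simps)
  show "norm (x - Y x) \<ge> (1 - norm Y) * norm x" by (rule lb)
  have "inj (\<lambda>x. x - Y x)"
  proof (rule injI)
    fix x y assume "x - Y x = y - Y y"
    then have "(x - y) - Y (x - y) = 0" by (simp add: blinfun.bilinear_simps algebra_simps)
    then have "(1 - norm Y) * norm (x - y) \<le> 0" using lb[of "x - y"] by simp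
    then show "x = y" using assms by (simp add: mult_le_0_iff)
  qed
  moreover have "surj (\<lambda>x. x - Y x)"
  proof (rule surjI)
    fix y
    have "\<exists>!x. y + Y x = x"
    proof (rule banach_fix_type[of "norm Y"])
      show "\<forall>u v. dist (y + Y u) (y + Y v) \<le> norm Y * dist u v"
        using norm_blinfun[of Y] by (auto simp: dist_norm blinfun.diff_right[symmetric])
    qed (use assms in auto)
    then have "(THE x. y + Y x = x) = y + Y (THE x. y + Y x = x)"
      by (metis (mono_tags, lifting) theI')
    then show "(THE x. y + Y x = x) - Y (THE x. y + Y x = x) = y"
      by (metis add_diff_cancel_right')
  qed
  ultimately show "bij (\<lambda>x. x - Y x)" by (simp add: bij_def)
qed

instance complex_hilbert_space \<subseteq> banach ..

text \<open>After division by \<open>M\<close> the form \<open>b\<close> corresponds to an operator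
  1 - R with R nonnegative and of norm below 1. If 1 - Y is its self-adjoint square root, then |(1 -
  Y) x|^2 = b x x / M, and \<open>A\<close> is 1 - Y rescaled by \<open>sqrt M\<close>.\<close>

lemma form_square_root:
  fixes b :: "'a::complex_hilbert_space \<Rightarrow> 'a \<Rightarrow> real"
  assumes lin: "\<And>y. linear (\<lambda>x. b x y)" and sym: "\<And>x y. b x y = b y x"
    and scaleC: "\<And>c x y. b (c *\<^sub>C x) y = b x (cnj c *\<^sub>C y)"
    and c: "c > 0" "\<And>x. c * (norm x)\<^sup>2 \<le> b x x" and le: "\<And>x. b x x \<le> M * (norm x)\<^sup>2"
    and M: "M > 0"
  obtains A A' :: "'a \<Rightarrow> 'a" where "bounded_clinear A" "bounded_clinear A'"
    "A \<circ> A' = id" "A' \<circ> A = id" "\<And>x. (norm (A x))\<^sup>2 = b x x"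
proof -
  \<comment> \<open>The minimum keeps \<open>q\<close> nonnegative even when \<open>c > M\<close>,
    which the two bounds on \<open>b\<close> permit on the zero space.\<close>
  define e where "e = min c M / M"
  define q where "q = 1 - e"
  have e: "0 < e" "e \<le> 1" "e * M \<le> c" using c(1) M by (auto simp: e_def)
  then have q: "0 \<le> q" "q < 1" by (auto simp: q_def)
  define r where "r x y = inner x y - b x y / M" for x y
  have "linear (\<lambda>x. r x y)" for y
    unfolding r_def using linear_add[OF lin[of y]] linear_cmul[OF lin[of y]]
    by (intro linearI) (simp_all add: inner_add_left add_divide_distrib algebra_simps)
  moreover have rsym: "r x y = r y x" for x y
    by (simp add: r_def inner_commute sym)
  moreover have "0 \<le> r x x" for x
    using le[of x] M by (simp add: r_def field_simps power2_norm_eq_inner)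
  moreover have "r x x \<le> q * (norm x)\<^sup>2" for x
  proof -
    have "e * M * (norm x)\<^sup>2 \<le> b x x"
      using mult_right_mono[OF e(3), of "(norm x)\<^sup>2"] c(2)[of x] by simp
    then have "e * (norm x)\<^sup>2 \<le> b x x / M" using M by (simp add: field_simps)
    then show ?thesis by (simp add: r_def q_def left_diff_distrib power2_norm_eq_inner)
  qed
  ultimately obtain R :: "'a \<Rightarrow>\<^sub>L 'a" where R: "norm R \<le> q" "\<And>x y. inner (R x) y = r x y"
    using form_operator[of r q] q(1) by blast
  have Rsym: "inner (R x) y = inner x (R y)" for x y
    using R(2) rsym by (metis inner_commute)
  have RC: "R (a *\<^sub>C x) = a *\<^sub>C R x" for a x
  proof -
    have "inner (R (a *\<^sub>C x)) z = inner (a *\<^sub>C R x) z" for z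
      by (simp add: R(2) inner_scaleC_left) (simp add: r_def inner_scaleC_left scaleC)
    then show ?thesis using vector_eq_rdot by blast
  qed
  \<comment> \<open>The commuting family is that of all complex scalar multiplications, so that
    \<open>Y\<close> is complex linear.\<close>
  obtain Y :: "'a \<Rightarrow>\<^sub>L 'a" where Y: "norm Y \<le> q" "\<And>x y. inner (Y x) y = inner x (Y y)"
    and YC: "\<And>a x. Y (a *\<^sub>C x) = a *\<^sub>C Y x" and YR: "\<And>x. 2 *\<^sub>R Y x = R x + Y (Y x)"
    by (rule selfadjoint_sqrt_fixpoint[OF R(1) q(2) Rsym bounded_linear_scaleC RC])
      (rule that; assumption)
  have Y1: "norm Y < 1" using Y(1) q(2) by simp
  define G where "G x = x - Y x" for x
  have bij: "bij G" and lb: "(1 - norm Y) * norm x \<le> norm (G x)" for x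
    unfolding G_def by (rule bij_diff_contraction[OF Y1])+
  have inv: "G (inv G x) = x" "inv G (G x) = x" for x
    using bij by (simp_all add: bij_is_surj surj_f_inv_f bij_is_inj)
  have Gadd: "G (x + y) = G x + G y" and GR: "G (s *\<^sub>R x) = s *\<^sub>R G x"
    and GC: "G (a *\<^sub>C x) = a *\<^sub>C G x" for x y s a
    by (simp_all add: G_def blinfun.bilinear_simps YC algebra_simps complex_vector.scale_right_diff_distrib)
  have G: "bounded_clinear G"
    unfolding bounded_clinear_def
    by (auto simp: GC) (unfold G_def, intro bounded_linear_intros)
  have invadd: "inv G (x + y) = inv G x + inv G y" and invR: "inv G (s *\<^sub>R x) = s *\<^sub>R inv G x"
    and invC: "inv G (a *\<^sub>C x) = a *\<^sub>C inv G x" for x y s a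
    using Gadd GR GC inv by metis+
  have invG: "bounded_clinear (inv G)"
    unfolding bounded_clinear_def
  proof (intro conjI allI invC bounded_linear_intro[of _ "1 / (1 - norm Y)"] invadd invR)
    show "norm (inv G x) \<le> norm x * (1 / (1 - norm Y))" for x
      using lb[of "inv G x"] Y1 by (simp add: inv field_simps)
  qed
  have GG: "(norm (G x))\<^sup>2 = b x x / M" for x
  proof -
    \<comment> \<open>Self-adjointness of \<open>Y\<close> turns the square of the norm into the
      form of 1 - 2 Y + Y^2, which is 1 - R by the fixed point equation.\<close>
    have "(norm (G x))\<^sup>2 = inner x x - inner (2 *\<^sub>R Y x) x + inner (Y (Y x)) x"
      by (simp add: G_def power2_norm_eq_inner inner_simps inner_commute
          flip: Y(2)[of x "Y x"])
    also have "\<dots> = inner x x - inner (R x) x"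
      by (simp only: YR inner_add_left)
    finally show ?thesis by (simp add: R(2) r_def)
  qed
  have comp: "bounded_clinear (\<lambda>x. s *\<^sub>R f x)" if f: "bounded_clinear f" for s and f :: "'a \<Rightarrow> 'a"
    unfolding bounded_clinear_def
  proof (intro conjI allI)
    show "bounded_linear (\<lambda>x. s *\<^sub>R f x)"
      using f unfolding bounded_clinear_def
      by (auto intro: bounded_linear_compose[OF bounded_linear_scaleR_right])
    show "s *\<^sub>R f (a *\<^sub>C x) = a *\<^sub>C (s *\<^sub>R f x)" for a x
      using f unfolding bounded_clinear_def
      by (simp add: scaleC_scaleC mult.commute flip: scaleC_of_real)
  qed
  show thesis
  proof (rule that[of "\<lambda>x. sqrt M *\<^sub>R G x" "\<lambda>x. (1 / sqrt M) *\<^sub>R inv G x"])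
    show "(\<lambda>x. sqrt M *\<^sub>R G x) \<circ> (\<lambda>x. (1 / sqrt M) *\<^sub>R inv G x) = id"
      using M by (auto simp: fun_eq_iff GR inv)
    show "(\<lambda>x. (1 / sqrt M) *\<^sub>R inv G x) \<circ> (\<lambda>x. sqrt M *\<^sub>R G x) = id"
      using M by (auto simp: fun_eq_iff invR inv)
    show "(norm (sqrt M *\<^sub>R G x))\<^sup>2 = b x x" for x
      using M GG[of x] by (simp add: power_mult_distrib)
  qed (rule comp G invG)+
qed

subsection \<open>Coercive forms\<close>

text \<open>The Baire half of the open mapping theorem. The closed range is a complete space covered
  by the sets \<open>D n\<close>, so one of them has interior in it; translation and scaling give
  approximate preimages of controlled norm.\<close>

lemma closed_range_lift_approx:
  fixes K :: "'a::banach \<Rightarrow> 'b::banach"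
  assumes K: "bounded_linear K" and cl: "closed (range K)"
  obtains C where "C > 0"
    "\<And>y. y \<in> range K \<Longrightarrow> \<exists>x. norm x \<le> C * norm y \<and> norm (y - K x) \<le> norm y / 2"
proof -
  interpret K: bounded_linear K by fact
  define X where "X = top_of_set (range K)"
  define D where "D n = closure (K ` cball 0 (real n))" for n :: nat
  have Dsub: "D n \<subseteq> range K" for n
    unfolding D_def by (rule closure_minimal[OF _ cl]) auto
  have "completely_metrizable_space X"
    unfolding X_def using cl closed_closedin completely_metrizable_space_closedin
      completely_metrizable_space_euclidean by blast
  moreover have "closedin X (D n)" for n
    unfolding X_def using Dsub[of n] by (intro closed_subset) (auto simp: D_def)
  moreover have "\<Union>(range D) = range K"
  proof
    show "range K \<subseteq> \<Union>(range D)"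
    proof
      fix y assume "y \<in> range K"
      then obtain x where x: "y = K x" by blast
      obtain n where "norm x \<le> real n"
        using real_arch_simple by blast
      then have "y \<in> D n"
        unfolding D_def x by (intro subsetD[OF closure_subset]) auto
      then show "y \<in> \<Union>(range D)" by blast
    qed
  qed (use Dsub in blast)
  moreover have "X interior_of (range K) = range K"
    unfolding X_def by (metis interior_of_topspace topspace_euclidean_subtopology)
  ultimately obtain n where "X interior_of (D n) \<noteq> {}"
    using Baire_category_alt[of X "range D"] by auto
  then obtain y0 where "y0 \<in> X interior_of (D n)" by blast
  then obtain U where U: "openin X U" "y0 \<in> U" "U \<subseteq> D n"
    by (auto simp: interior_of_def)
  then obtain e where e: "e > 0" "\<And>y. y \<in> range K \<Longrightarrow> dist y y0 < e \<Longrightarrow> y \<in> U"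
    unfolding X_def openin_euclidean_subtopology_iff by blast
  have y0: "y0 \<in> range K" "y0 \<in> D n"
    using U Dsub by blast+
  \<comment> \<open>A small \<open>y\<close> is the difference of \<open>y0 + y\<close> and
    \<open>y0\<close>, both limits of images of the ball of radius \<open>n\<close>. This explains
    the radius \<open>2 * real n\<close>.\<close>
  have approx: "\<exists>x. norm x \<le> 2 * real n \<and> norm (y - K x) \<le> d"
    if y: "y \<in> range K" "norm y < e" and d: "d > 0" for y d
  proof -
    have "y0 + y \<in> range K"
      using y y0(1) K.add by (metis (no_types, lifting) rangeE rangeI)
    then have "y0 + y \<in> D n"
      using e(2)[of "y0 + y"] U(3) y(2) by (auto simp: dist_norm)
    then have "\<exists>w\<in>K ` cball 0 (real n). dist w (y0 + y) < d / 2"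
      unfolding D_def closure_approachable using half_gt_zero[OF d] by blast
    then obtain x1 where x1: "norm x1 \<le> real n" "dist (K x1) (y0 + y) < d / 2"
      by auto
    have "\<exists>w\<in>K ` cball 0 (real n). dist w y0 < d / 2"
      using y0(2) half_gt_zero[OF d] unfolding D_def closure_approachable by blast
    then obtain x2 where x2: "norm x2 \<le> real n" "dist (K x2) y0 < d / 2"
      by auto
    have "norm (y - K (x1 - x2)) = norm ((y0 + y - K x1) + (K x2 - y0))"
      by (simp add: K.diff algebra_simps)
    also have "\<dots> \<le> d / 2 + d / 2"
      using x1(2) x2(2) by (intro norm_triangle_le) (auto simp: dist_norm norm_minus_commute)
    finally show ?thesis
      using x1 x2 norm_triangle_ineq4[of x1 x2] by (intro exI[of _ "x1 - x2"]) auto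
  qed
  \<comment> \<open>Below, \<open>y\<close> is scaled to norm e / 2 and approximated within e / 4;
    scaling back gives the error |y| / 2 and the factor 4 n / e. The extra 1 keeps \<open>C\<close>
    positive when \<open>n = 0\<close>.\<close>
  define C where "C = (4 * real n + 1) / e"
  have "C > 0"
    using e by (simp add: C_def add_nonneg_pos)
  moreover have "\<exists>x. norm x \<le> C * norm y \<and> norm (y - K x) \<le> norm y / 2"
    if y: "y \<in> range K" for y
  proof (cases "y = 0")
    case True
    then show ?thesis by (intro exI[of _ 0]) (simp add: K.zero)
  next
    case False
    define s where "s = e / (2 * norm y)"
    have s: "s > 0" using e False by (simp add: s_def)
    have "s *\<^sub>R y \<in> range K"
      using y by (metis (no_types, lifting) K.scaleR rangeE rangeI)
    moreover have "norm (s *\<^sub>R y) < e"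
      using e False by (simp add: s_def)
    moreover have "e / 4 > 0"
      using e by simp
    ultimately obtain x where x: "norm x \<le> 2 * real n" "norm (s *\<^sub>R y - K x) \<le> e / 4"
      using approx by blast
    have "norm (inverse s *\<^sub>R x) = norm x / s"
      using s by (simp add: divide_inverse)
    also have "\<dots> \<le> 2 * real n / s"
      using x(1) s by (simp add: divide_right_mono)
    also have "\<dots> = 4 * real n / e * norm y"
      by (simp add: s_def)
    also have "\<dots> \<le> C * norm y"
      using e by (intro mult_right_mono) (auto simp: C_def divide_right_mono)
    finally have 1: "norm (inverse s *\<^sub>R x) \<le> C * norm y" .
    have "y - K (inverse s *\<^sub>R x) = inverse s *\<^sub>R (s *\<^sub>R y - K x)"
      using s by (simp add: K.scaleR scaleR_right_diff_distrib)
    then have "norm (y - K (inverse s *\<^sub>R x)) = norm (s *\<^sub>R y - K x) / s"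
      using s by (simp add: divide_inverse)
    also have "\<dots> \<le> (e / 4) / s"
      by (intro divide_right_mono x(2)) (use s in simp)
    also have "\<dots> = norm y / 2"
      using e by (simp add: s_def field_simps)
    finally show ?thesis using 1 by blast
  qed
  ultimately show thesis using that by blast
qed

text \<open>Successive correction: approximate lifting halves the residual each time, so the
  corrections form an absolutely convergent series, whose sum is an exact preimage.\<close>

lemma closed_range_lift:
  fixes K :: "'a::banach \<Rightarrow> 'b::banach"
  assumes K: "bounded_linear K" and cl: "closed (range K)"
  obtains C where "C > 0" "\<And>y. y \<in> range K \<Longrightarrow> \<exists>x. K x = y \<and> norm x \<le> C * norm y"
proof -
  interpret K: bounded_linear K by fact
  obtain C g where C: "C > 0"
    and g: "\<And>y. y \<in> range K \<Longrightarrow> norm (g y) \<le> C * norm y \<and> norm (y - K (g y)) \<le> norm y / 2"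
    using closed_range_lift_approx[OF assms] by metis
  have "\<exists>x. K x = y \<and> norm x \<le> 2 * C * norm y" if y: "y \<in> range K" for y
  proof -
    \<comment> \<open>The residual after \<open>k\<close> corrections. It stays in the range of
      \<open>K\<close>, where \<open>g\<close> is controlled.\<close>
    define r where "r k = ((\<lambda>z. z - K (g z)) ^^ k) y" for k
    have rSuc: "r (Suc k) = r k - K (g (r k))" for k
      by (simp add: r_def)
    have r: "r k \<in> range K \<and> norm (r k) \<le> (1 / 2) ^ k * norm y" for k
    proof (induction k)
      case 0
      then show ?case using y by (simp add: r_def)
    next
      case (Suc k)
      then obtain x where "r k = K x" by blast
      then have "r (Suc k) = K (x - g (r k))"
        by (simp add: rSuc K.diff)
      with Suc g[of "r k"] show ?case
        by (auto simp: rSuc)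
    qed
    have gr: "norm (g (r k)) \<le> (1 / 2) ^ k * (C * norm y)" for k
    proof -
      have "norm (g (r k)) \<le> C * norm (r k)"
        using g r by blast
      also have "\<dots> \<le> C * ((1 / 2) ^ k * norm y)"
        using r C by (intro mult_left_mono) auto
      finally show ?thesis by (simp add: algebra_simps)
    qed
    have geo: "(\<lambda>k. (1 / 2) ^ k * (C * norm y)) sums (2 * (C * norm y))"
      using sums_mult2[OF geometric_sums[of "1 / 2 :: real"]] by simp
    have sn: "summable (\<lambda>k. norm (g (r k)))"
      by (rule summable_comparison_test'[OF sums_summable[OF geo]]) (use gr in auto)
    define x where "x = (\<Sum>k. g (r k))"
    have gx: "(\<lambda>k. g (r k)) sums x"
      unfolding x_def using summable_norm_cancel[OF sn] by (rule summable_sums)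
    have "norm x \<le> (\<Sum>k. norm (g (r k)))"
      unfolding x_def by (rule summable_norm[OF sn])
    also have "\<dots> \<le> 2 * (C * norm y)"
      using suminf_le[OF gr sn sums_summable[OF geo]] sums_unique[OF geo] by simp
    finally have nx: "norm x \<le> 2 * C * norm y" by simp
    have "r \<longlonglongrightarrow> 0"
    proof (rule Lim_null_comparison)
      show "(\<lambda>k. (1 / 2) ^ k * norm y) \<longlonglongrightarrow> 0"
        by (intro tendsto_mult_left_zero LIMSEQ_power_zero) simp
    qed (use r in auto)
    then have "(\<lambda>k. r k - r (Suc k)) sums (r 0 - 0)"
      by (rule telescope_sums')
    then have "(\<lambda>k. K (g (r k))) sums y"
      by (simp add: rSuc r_def[of 0])
    moreover have "(\<lambda>k. K (g (r k))) sums K x"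
      by (rule K.sums[OF gx])
    ultimately have "K x = y"
      using sums_unique2 by blast
    with nx show ?thesis by blast
  qed
  then show thesis
    using that[of "2 * C"] C by auto
qed

text \<open>Otherwise there are unit vectors \<open>X n\<close> with \<open>b (X n) (X n)\<close>
  tending to 0, hence with \<open>K (X n)\<close> tending to 0. Bounded lifts \<open>v n\<close> of
  these images tend to 0, and the vectors \<open>X n - v n\<close> lie in a compact part of the
  kernel. A subsequence of \<open>X\<close> thus converges to a unit vector on which
  \<open>b\<close> vanishes, against definiteness.\<close>

lemma form_coercive:
  fixes b :: "'a::{real_inner,banach} \<Rightarrow> 'a \<Rightarrow> real" and K :: "'a \<Rightarrow> 'b::banach"
  assumes lin: "\<And>y. linear (\<lambda>x. b x y)" and sym: "\<And>x y. b x y = b y x"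
    and pos: "\<And>x. x \<noteq> 0 \<Longrightarrow> 0 < b x x"
    and le: "\<And>x. b x x \<le> M * (norm x)\<^sup>2"
    and K: "bounded_linear K" "closed (range K)"
    and ker: "\<And>r. compact (op_kernel K \<inter> cball 0 r)"
    and m: "m > 0" and lower: "\<And>x. m * (norm (K x))\<^sup>2 \<le> b x x"
  obtains c where "c > 0" "\<And>x. c * (norm x)\<^sup>2 \<le> b x x"
proof (rule ccontr)
  assume "\<not> thesis"
  interpret K: bounded_linear K by (rule K(1))
  have sc: "b (s *\<^sub>R u) w = s * b u w" for u w s
    using linear_cmul[OF lin] by auto
  have sc': "b w (s *\<^sub>R u) = s * b w u" for u w s
    using sc sym by metis
  have diff: "b (u - v) w = b u w - b v w" and diff': "b w (u - v) = b w u - b w v" for u v w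
    using linear_diff[OF lin] sym by metis+
  have nonneg: "0 \<le> b x x" for x
    using pos[of x] sc[of 0 0 0] by (cases "x = 0") auto
  have "\<exists>x. norm x = 1 \<and> b x x < inverse (real (Suc n))" for n
  proof -
    have "\<not> (\<forall>x. inverse (real (Suc n)) * (norm x)\<^sup>2 \<le> b x x)"
      using that[of "inverse (real (Suc n))"] \<open>\<not> thesis\<close> by auto
    then obtain x where x: "b x x < inverse (real (Suc n)) * (norm x)\<^sup>2"
      by (auto simp: not_le)
    then have "x \<noteq> 0" using nonneg[of x] by auto
    define y where "y = inverse (norm x) *\<^sub>R x"
    have "norm y = 1" using \<open>x \<noteq> 0\<close> by (simp add: y_def)
    moreover have "b y y = b x x / (norm x)\<^sup>2"
      by (simp add: y_def sc sc' power2_eq_square divide_inverse)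
    then have "b y y < inverse (real (Suc n))"
      using x \<open>x \<noteq> 0\<close> by (simp add: pos_divide_less_eq)
    ultimately show ?thesis by blast
  qed
  then obtain X where X: "\<And>n. norm (X n) = 1" "\<And>n. b (X n) (X n) < inverse (real (Suc n))"
    by metis
  obtain C where C: "C > 0" "\<And>y. y \<in> range K \<Longrightarrow> \<exists>x. K x = y \<and> norm x \<le> C * norm y"
    using closed_range_lift[OF K] by blast
  then have "\<exists>v. K v = K (X n) \<and> norm v \<le> C * norm (K (X n))" for n by blast
  then obtain v where v: "\<And>n. K (v n) = K (X n)" "\<And>n. norm (v n) \<le> C * norm (K (X n))"
    by metis
  have b0: "(\<lambda>n. b (X n) (X n)) \<longlonglongrightarrow> 0"
    by (rule Lim_null_comparison[OF _ LIMSEQ_inverse_real_of_nat])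
      (use X(2) nonneg in \<open>auto intro!: always_eventually less_imp_le\<close>)
  have "(\<lambda>n. (norm (K (X n)))\<^sup>2) \<longlonglongrightarrow> 0"
  proof (rule Lim_null_comparison)
    show "(\<lambda>n. b (X n) (X n) / m) \<longlonglongrightarrow> 0"
      using tendsto_divide_zero[OF b0] .
    show "\<forall>\<^sub>F n in sequentially. norm ((norm (K (X n)))\<^sup>2) \<le> b (X n) (X n) / m"
      using lower m by (auto simp: field_simps)
  qed
  then have "(\<lambda>n. sqrt ((norm (K (X n)))\<^sup>2)) \<longlonglongrightarrow> sqrt 0"
    by (rule tendsto_real_sqrt)
  then have "(\<lambda>n. norm (K (X n))) \<longlonglongrightarrow> 0" by simp
  then have "(\<lambda>n. C * norm (K (X n))) \<longlonglongrightarrow> 0"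
    by (rule tendsto_mult_right_zero)
  then have v0: "v \<longlonglongrightarrow> 0"
    by (rule Lim_null_comparison[rotated]) (use v in auto)
  then obtain r where r: "\<And>n. norm (v n) \<le> r"
    using convergent_imp_bounded[OF v0] unfolding bounded_iff by blast
  have "X n - v n \<in> op_kernel K \<inter> cball 0 (1 + r)" for n
    using norm_triangle_ineq4[of "X n" "v n"] X(1)[of n] r[of n] v(1)
    by (simp add: op_kernel_def K.diff)
  then obtain u \<sigma> where \<sigma>: "strict_mono (\<sigma> :: nat \<Rightarrow> nat)"
    and Xv: "((\<lambda>n. X n - v n) \<circ> \<sigma>) \<longlonglongrightarrow> u"
    using seq_compactE[OF compact_imp_seq_compact[OF ker], of "\<lambda>n. X n - v n" "1 + r"] by blast
  have "(v \<circ> \<sigma>) \<longlonglongrightarrow> 0"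
    using v0 \<sigma> by (rule LIMSEQ_subseq_LIMSEQ)
  with Xv have "(\<lambda>n. ((\<lambda>n. X n - v n) \<circ> \<sigma>) n + (v \<circ> \<sigma>) n) \<longlonglongrightarrow> u + 0"
    by (rule tendsto_add)
  then have Xu: "(\<lambda>n. X (\<sigma> n)) \<longlonglongrightarrow> u" by (simp add: o_def)
  then have "(\<lambda>n. norm (X (\<sigma> n))) \<longlonglongrightarrow> norm u" by (rule tendsto_norm)
  then have "norm u = 1" using X(1) by (simp add: LIMSEQ_const_iff)
  have "(\<lambda>n. 2 * (M * (norm (u - X (\<sigma> n)))\<^sup>2) + 2 * b (X (\<sigma> n)) (X (\<sigma> n)))
      \<longlonglongrightarrow> 2 * (M * (norm (u - u))\<^sup>2) + 2 * 0"
    using LIMSEQ_subseq_LIMSEQ[OF b0 \<sigma>] by (intro tendsto_intros Xu) (simp add: o_def)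
  \<comment> \<open>This is b(u) \<le> 2 b(u - w) + 2 b(w), from the parallelogram identity for
    \<open>b\<close>. The upper bound on \<open>b\<close> makes the first term small as w tends to
    u.\<close>
  moreover have "b u u \<le> 2 * (M * (norm (u - X (\<sigma> n)))\<^sup>2) + 2 * b (X (\<sigma> n)) (X (\<sigma> n))" for n
  proof -
    define w where "w = X (\<sigma> n)"
    have "0 \<le> b ((u - w) - w) ((u - w) - w)" by (rule nonneg)
    then have "b u u \<le> 2 * b (u - w) (u - w) + 2 * b w w"
      by (simp add: diff diff' sym[of w u])
    with le[of "u - w"] show ?thesis by (simp add: w_def)
  qed
  ultimately have "b u u \<le> 2 * (M * (norm (u - u))\<^sup>2) + 2 * 0"
    by (intro LIMSEQ_le_const) auto
  moreover have "u \<noteq> 0" using \<open>norm u = 1\<close> by auto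
  ultimately show False using pos[of u] by auto
qed

subsection \<open>The invariant limit form\<close>

text \<open>Tychonoff's theorem gives a cluster point \<open>q\<close> of the sequence in a product
  of compact intervals. Over an arbitrary index set a convergent subsequence may fail to exist, so
  convergence is along a filter finer than \<open>sequentially\<close>.\<close>

lemma pointwise_bounded_limit_filter:
  fixes f :: "nat \<Rightarrow> 'b \<Rightarrow> real"
  assumes "\<And>n x. \<bar>f n x\<bar> \<le> B x"
  obtains F q where "F \<noteq> bot" "F \<le> sequentially" "\<And>x. ((\<lambda>n. f n x) \<longlongrightarrow> q x) F"
proof -
  define S where "S = PiE UNIV (\<lambda>x. {- B x..B x})"
  have "compactin (product_topology (\<lambda>_. euclidean) UNIV) S"
    unfolding S_def compactin_PiE by (auto simp: compactin_euclidean_iff)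
  then have "compact S"
    by (simp add: euclidean_product_topology compactin_euclidean_iff)
  moreover have "eventually (\<lambda>g. g \<in> S) (filtermap f sequentially)"
    using assms by (auto simp: eventually_filtermap S_def PiE_def abs_le_iff minus_le_iff)
  moreover have "filtermap f sequentially \<noteq> bot"
    by (simp add: filtermap_bot_iff)
  ultimately obtain q where q: "inf (nhds q) (filtermap f sequentially) \<noteq> bot"
    unfolding compact_filter by blast
  \<comment> \<open>Generated by the tails of the naturals and the preimages of the neighbourhoods
    of \<open>q\<close>; it is proper because \<open>q\<close> is a cluster point.\<close>
  define F where "F = inf sequentially (filtercomap f (nhds q))"
  have "F \<noteq> bot"
  proof
    assume "F = bot"
    then have "eventually (\<lambda>_. False) F"
      by simp
    then obtain P Q where P: "eventually P sequentially"
      and Q: "eventually Q (nhds q)" and PQ: "\<And>n. P n \<Longrightarrow> Q (f n) \<Longrightarrow> False"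
      unfolding F_def eventually_inf eventually_filtercomap by blast
    have "eventually (\<lambda>g. \<not> Q g) (filtermap f sequentially)"
      unfolding eventually_filtermap using P by eventually_elim (use PQ in blast)
    with Q have "eventually (\<lambda>_. False) (inf (nhds q) (filtermap f sequentially))"
      unfolding eventually_inf by blast
    with q show False
      by (simp add: trivial_limit_def)
  qed
  moreover have "F \<le> sequentially"
    by (simp add: F_def)
  moreover have "((\<lambda>n. f n x) \<longlongrightarrow> q x) F" for x
  proof -
    have "filterlim f (nhds q) F"
      by (simp add: F_def filterlim_iff_le_filtercomap)
    moreover have "((\<lambda>g. g x) \<longlongrightarrow> q x) (nhds q)"
    proof -
      have "((\<lambda>g. g x) \<longlongrightarrow> q x) (at q)"
        using continuous_on_product_coordinates[of x] unfolding continuous_on_def by blast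
      then show ?thesis
        using tendsto_at_iff_tendsto_nhds[of "\<lambda>g. g x" q] by simp
    qed
    ultimately show ?thesis
      by (rule filterlim_compose[rotated])
  qed
  ultimately show thesis
    using that by blast
qed

section \<open>Repeated averages and their asymptotic invariance\<close>

definition cesaro_mean :: "('a::real_inner \<Rightarrow> 'a) \<Rightarrow> nat \<Rightarrow> 'a \<Rightarrow> 'a \<Rightarrow> real"
  where "cesaro_mean T N x y = (\<Sum>n<N. inner ((T ^^ n) x) ((T ^^ n) y)) / real N"

text \<open>
  A single average need not be asymptotically \<open>T\<close>-invariant: replacing \<open>x\<close> by \<open>T x\<close> changes it by
  \<open>(\<parallel>T\<^sup>N x\<parallel>\<^sup>2 - \<parallel>x\<parallel>\<^sup>2) / N\<close>, which is only known to be bounded. The second average makes these errors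
  telescope, up to a term of order \<open>N\<close> to the power \<open>-1/2\<close>.
\<close>

definition cesaro_mean2 :: "('a::real_inner \<Rightarrow> 'a) \<Rightarrow> nat \<Rightarrow> 'a \<Rightarrow> 'a \<Rightarrow> real"
  where "cesaro_mean2 T N x y = (\<Sum>k<N. cesaro_mean T (Suc k) x y) / real N"

text \<open>The condition \<open>c \<ge> 0\<close> covers \<open>N = 0\<close>, where the quotient
  is 0 by convention.\<close>

lemma average_le:
  fixes f :: "nat \<Rightarrow> real"
  assumes "\<And>k. f k \<le> c" and "c \<ge> 0"
  shows "(\<Sum>k<N. f k) / real N \<le> c"
proof (cases "N = 0")
  case False
  have "(\<Sum>k<N. f k) \<le> real N * c"
    using sum_bounded_above[of "{..<N}" f c] assms by simp
  then show ?thesis using False by (simp add: field_simps)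
qed (use assms in simp)

lemma average_ge:
  fixes f :: "nat \<Rightarrow> real"
  assumes "\<And>k. f k \<ge> c" and "N > 0"
  shows "(\<Sum>k<N. f k) / real N \<ge> c"
proof -
  have "(\<Sum>k<N. f k) \<ge> real N * c"
    using sum_bounded_below[of "{..<N}" c f] assms by simp
  then show ?thesis using \<open>N > 0\<close> by (simp add: field_simps)
qed

text \<open>Both longer averages are expressed through the sum \<open>s\<close> of the squared norms
  of T x, ..., T^(k+1) x. The form of the right-hand side separates a difference that telescopes in
  \<open>k\<close> from an error of order 1/k.\<close>

lemma cesaro_mean_shift:
  "cesaro_mean T (Suc k) (T x) (T x) - cesaro_mean T (Suc k) x x
    = cesaro_mean T (Suc (Suc k)) x x - cesaro_mean T (Suc k) x x
      + (cesaro_mean T (Suc (Suc k)) x x - (norm x)\<^sup>2) / real (Suc k)"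
proof -
  let ?a = "\<lambda>n. inner ((T ^^ n) x) ((T ^^ n) x)"
  define s where "s = (\<Sum>n<Suc k. ?a (Suc n))"
  have 1: "cesaro_mean T (Suc k) (T x) (T x) = s / real (Suc k)"
    unfolding cesaro_mean_def s_def by (simp only: funpow_swap1 funpow.simps comp_apply)
  have "(\<Sum>n<Suc (Suc k). ?a n) = (norm x)\<^sup>2 + s"
    unfolding s_def by (subst sum.lessThan_Suc_shift) (simp add: power2_norm_eq_inner)
  then have 2: "cesaro_mean T (Suc (Suc k)) x x = ((norm x)\<^sup>2 + s) / real (Suc (Suc k))"
    by (simp only: cesaro_mean_def)
  have "u / (p + 1) + u / (p + 1) / p = u / p" if "p > 0" for u p :: real
    using that by (simp add: divide_simps) (simp add: algebra_simps)
  from this[of "real (Suc k)" "(norm x)\<^sup>2 + s"]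
  have "s / real (Suc k) = ((norm x)\<^sup>2 + s) / (real (Suc k) + 1)
      + (((norm x)\<^sup>2 + s) / (real (Suc k) + 1) - (norm x)\<^sup>2) / real (Suc k)"
    by (simp only: diff_divide_distrib add_divide_distrib[of _ _ "real (Suc k)"]) simp
  then show ?thesis
    unfolding 1 2 by (simp add: add.commute)
qed

text \<open>The increment 2 (b - a) equals 2 / (b + a), which is at least 1 / b and so at least 1 /
  b^2. Any sublinear bound suffices for the averaging that follows.\<close>

lemma sum_inverse_le_sqrt: "(\<Sum>k<N. 1 / real (Suc k)) \<le> 2 * sqrt (real N)"
proof (induction N)
  case (Suc N)
  define a where "a = sqrt (real N)"
  define b where "b = sqrt (real (Suc N))"
  have ab: "0 \<le> a" "0 < b" "b\<^sup>2 = a\<^sup>2 + 1" "real (Suc N) = b\<^sup>2" "a \<le> b"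
    by (auto simp: a_def b_def)
  have "1 = (b - a) * (b + a)"
    using ab(3) by (simp add: power2_eq_square algebra_simps)
  also have "\<dots> \<le> (b - a) * (2 * b)"
    using ab by (intro mult_left_mono) auto
  finally have "1 \<le> (2 * (b - a)) * b" by (simp add: algebra_simps)
  also have "\<dots> \<le> (2 * (b - a)) * b\<^sup>2"
  proof -
    have "1 \<le> b" by (simp add: b_def)
    then have "b \<le> b\<^sup>2" by (simp add: power2_eq_square)
    then show ?thesis using ab by (intro mult_left_mono) auto
  qed
  finally have "1 / b\<^sup>2 \<le> 2 * (b - a)"
    using ab(2) by (simp add: field_simps)
  then show ?case
    using Suc.IH ab(4) by (simp add: a_def b_def)
qed simp

text \<open>Summing the shift identity over \<open>k\<close>, the telescoping part is a difference
  of two numbers in [0, D], and the remaining errors add up to at most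
  \<open>2 * D * sqrt N\<close>. Division by \<open>N\<close> sends both to 0.\<close>

lemma cesaro_mean2_shift:
  assumes M: "\<And>N. cesaro_mean T (Suc N) x x \<le> D" and D: "(norm x)\<^sup>2 \<le> D"
  shows "(\<lambda>N. cesaro_mean2 T N (T x) (T x) - cesaro_mean2 T N x x) \<longlonglongrightarrow> 0"
proof (rule Lim_null_comparison)
  let ?A = "\<lambda>k. cesaro_mean T (Suc k) x x"
  have A: "0 \<le> ?A k" for k
    unfolding cesaro_mean_def by (intro divide_nonneg_nonneg sum_nonneg) auto
  have D0: "0 \<le> D" using D zero_le_power2 order_trans by blast
  show "\<forall>\<^sub>F N in sequentially. norm (cesaro_mean2 T N (T x) (T x) - cesaro_mean2 T N x x)
      \<le> (D + D * (2 * sqrt (real N))) / real N"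
  proof (intro always_eventually allI)
    fix N
    have "cesaro_mean2 T N (T x) (T x) - cesaro_mean2 T N x x
      = (\<Sum>k<N. cesaro_mean T (Suc k) (T x) (T x) - ?A k) / real N"
      by (simp add: cesaro_mean2_def sum_subtractf diff_divide_distrib)
    also have "(\<Sum>k<N. cesaro_mean T (Suc k) (T x) (T x) - ?A k)
      = (\<Sum>k<N. ?A (Suc k) - ?A k) + (\<Sum>k<N. (?A (Suc k) - (norm x)\<^sup>2) / real (Suc k))"
      by (simp only: cesaro_mean_shift sum.distrib)
    also have "(\<Sum>k<N. ?A (Suc k) - ?A k) = ?A N - ?A 0"
      by (rule sum_lessThan_telescope)
    finally have "norm (cesaro_mean2 T N (T x) (T x) - cesaro_mean2 T N x x)
      = \<bar>?A N - ?A 0 + (\<Sum>k<N. (?A (Suc k) - (norm x)\<^sup>2) / real (Suc k))\<bar> / real N"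
      by simp
    also have "\<dots> \<le> (D + D * (2 * sqrt (real N))) / real N"
    proof (intro divide_right_mono order_trans[OF abs_triangle_ineq] add_mono)
      show "\<bar>?A N - ?A 0\<bar> \<le> D"
        using A[of N] A[of 0] M[of N] M[of 0] by linarith
      have "\<bar>\<Sum>k<N. (?A (Suc k) - (norm x)\<^sup>2) / real (Suc k)\<bar> \<le> (\<Sum>k<N. D * (1 / real (Suc k)))"
      proof (rule order_trans[OF sum_abs sum_mono])
        fix k
        have "\<bar>?A (Suc k) - (norm x)\<^sup>2\<bar> \<le> D"
          using A[of "Suc k"] M[of "Suc k"] D zero_le_power2[of "norm x"] by linarith
        then show "\<bar>(?A (Suc k) - (norm x)\<^sup>2) / real (Suc k)\<bar> \<le> D * (1 / real (Suc k))"
          by (simp add: divide_right_mono)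
      qed
      also have "\<dots> \<le> D * (2 * sqrt (real N))"
        unfolding sum_distrib_left[symmetric]
        by (intro mult_left_mono sum_inverse_le_sqrt D0)
      finally show "\<bar>\<Sum>k<N. (?A (Suc k) - (norm x)\<^sup>2) / real (Suc k)\<bar> \<le> D * (2 * sqrt (real N))" .
    qed simp
    finally show "norm (cesaro_mean2 T N (T x) (T x) - cesaro_mean2 T N x x)
      \<le> (D + D * (2 * sqrt (real N))) / real N" .
  qed
  have "(D + D * (2 * sqrt (real N))) / real N = D * (1 / real N) + 2 * D * sqrt (1 / real N)" for N
    using real_sqrt_mult_self[of "real N"]
    by (cases "N = 0") (simp_all add: real_sqrt_divide field_simps del: real_sqrt_mult_self)
  moreover have "(\<lambda>N. D * (1 / real N) + 2 * D * sqrt (1 / real N))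
      \<longlonglongrightarrow> D * 0 + 2 * D * sqrt 0"
    by (intro tendsto_intros lim_1_over_n)
  ultimately show "(\<lambda>N. (D + D * (2 * sqrt (real N))) / real N) \<longlonglongrightarrow> 0"
    by simp
qed

text \<open>Termwise 2 |inner u v| \<le> |u|^2 + |v|^2. It bounds the off-diagonal values pointwise,
  as the compactness argument requires.\<close>

lemma abs_cesaro_mean_le:
  "2 * \<bar>cesaro_mean T N x y\<bar> \<le> cesaro_mean T N x x + cesaro_mean T N y y"
proof -
  have "\<bar>inner u v\<bar> \<le> (inner u u + inner v v) / 2" for u v :: 'a
  proof -
    have "0 \<le> inner (u - v) (u - v)" "0 \<le> inner (u + v) (u + v)"
      by (rule inner_ge_zero)+
    then show ?thesis by (simp add: inner_simps inner_commute[of v u] abs_le_iff)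
  qed
  then have "\<bar>\<Sum>n<N. inner ((T ^^ n) x) ((T ^^ n) y)\<bar>
      \<le> (\<Sum>n<N. (inner ((T ^^ n) x) ((T ^^ n) x) + inner ((T ^^ n) y) ((T ^^ n) y)) / 2)"
    by (intro order_trans[OF sum_abs sum_mono])
  then show ?thesis
    by (simp add: cesaro_mean_def sum.distrib add_divide_distrib divide_right_mono
        flip: sum_divide_distrib add_divide_distrib)
qed

text \<open>The form \<open>b\<close> is the limit of \<open>cesaro_mean2\<close> along a fixed
  filter, so identities and bounds valid for the averages pass to it. The lower bound is stated for
  any constant \<open>l\<close> because it serves twice: to dominate the form of \<open>K\<close>,
  and to bound \<open>b\<close> from below on an eigenvector.\<close>

lemma cesaro_limit_form:
  fixes T :: "'a::complex_inner \<Rightarrow> 'a"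
  assumes T: "bounded_clinear T" and M: "\<And>N x. cesaro_mean T (Suc N) x x \<le> M * (norm x)\<^sup>2"
    and M0: "M > 0"
  obtains b where "\<And>y. linear (\<lambda>x. b x y)" "\<And>x y. b x y = b y x"
    "\<And>c x y. b (c *\<^sub>C x) y = b x (cnj c *\<^sub>C y)"
    "\<And>x. b (T x) (T x) = b x x"
    "\<And>x l. \<forall>N. l \<le> cesaro_mean T (Suc N) x x \<Longrightarrow> l \<le> b x x"
    "\<And>x. b x x \<le> M * (norm x)\<^sup>2"
proof -
  have blT: "bounded_linear T" and TC: "\<And>c x. T (c *\<^sub>C x) = c *\<^sub>C T x"
    using T by (auto simp: bounded_clinear_def)
  interpret T: bounded_linear T by (rule blT)
  have powadd: "(T ^^ n) (x + y) = (T ^^ n) x + (T ^^ n) y" for n x y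
    by (induction n) (simp_all add: T.add)
  have powR: "(T ^^ n) (r *\<^sub>R x) = r *\<^sub>R (T ^^ n) x" for n r x
    by (induction n) (simp_all add: T.scaleR)
  have powC: "(T ^^ n) (c *\<^sub>C x) = c *\<^sub>C (T ^^ n) x" for n c x
    by (induction n) (simp_all add: TC)
  let ?B = "\<lambda>x y. M * ((norm x)\<^sup>2 + (norm y)\<^sup>2)"
  have A: "\<bar>cesaro_mean T (Suc k) x y\<bar> \<le> ?B x y" for k x y
    using abs_cesaro_mean_le[of T "Suc k" x y] M[of k x] M[of k y]
    by (simp add: distrib_left)
  have "\<bar>cesaro_mean2 T N x y\<bar> \<le> ?B x y" for N x y
  proof -
    have "\<bar>cesaro_mean2 T N x y\<bar> \<le> (\<Sum>k<N. \<bar>cesaro_mean T (Suc k) x y\<bar>) / real N"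
      by (simp add: cesaro_mean2_def divide_right_mono)
    also have "\<dots> \<le> ?B x y"
      using A M0 by (intro average_le) auto
    finally show ?thesis .
  qed
  then have "\<bar>(\<lambda>(x, y). cesaro_mean2 T N x y) p\<bar> \<le> (\<lambda>(x, y). ?B x y) p" for N p
    by (cases p) simp
  then obtain F q where F: "F \<noteq> bot" "F \<le> sequentially"
    and q: "\<And>p. ((\<lambda>N. (\<lambda>(x, y). cesaro_mean2 T N x y) p) \<longlongrightarrow> q p) F"
    by (rule pointwise_bounded_limit_filter[of "\<lambda>N (x, y). cesaro_mean2 T N x y"
          "\<lambda>(x, y). ?B x y"]) (rule that; assumption)
  define b where "b x y = q (x, y)" for x y
  have b: "((\<lambda>N. cesaro_mean2 T N x y) \<longlongrightarrow> b x y) F" for x y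
    using q[of "(x, y)"] by (simp add: b_def)
  have uniq: "b x y = l" if "((\<lambda>N. cesaro_mean2 T N x y) \<longlongrightarrow> l) F" for x y l
    using tendsto_unique[OF F(1) b that] .
  show thesis
  proof (rule that[of b])
    show "linear (\<lambda>x. b x y)" for y
    proof (rule linearI)
      show "b (u + v) y = b u y + b v y" for u v
      proof (rule uniq)
        have "cesaro_mean2 T N (u + v) y = cesaro_mean2 T N u y + cesaro_mean2 T N v y" for N
          by (simp add: cesaro_mean2_def cesaro_mean_def powadd inner_add_left sum.distrib
              add_divide_distrib)
        then show "((\<lambda>N. cesaro_mean2 T N (u + v) y) \<longlongrightarrow> b u y + b v y) F"
          by (simp add: tendsto_add[OF b b])
      qed
      show "b (r *\<^sub>R u) y = r *\<^sub>R b u y" for r u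
      proof (rule uniq)
        have "cesaro_mean2 T N (r *\<^sub>R u) y = r *\<^sub>R cesaro_mean2 T N u y" for N
          by (simp add: cesaro_mean2_def cesaro_mean_def powR flip: sum_distrib_left times_divide_eq_right)
        then show "((\<lambda>N. cesaro_mean2 T N (r *\<^sub>R u) y) \<longlongrightarrow> r *\<^sub>R b u y) F"
          by (simp only:) (intro tendsto_intros b)
      qed
    qed
    show "b x y = b y x" for x y
    proof (rule uniq)
      have "cesaro_mean2 T N x y = cesaro_mean2 T N y x" for N
        by (simp add: cesaro_mean2_def cesaro_mean_def inner_commute)
      then show "((\<lambda>N. cesaro_mean2 T N x y) \<longlongrightarrow> b y x) F"
        by (simp add: b)
    qed
    show "b (c *\<^sub>C x) y = b x (cnj c *\<^sub>C y)" for c x y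
    proof (rule uniq)
      have "cesaro_mean2 T N (c *\<^sub>C x) y = cesaro_mean2 T N x (cnj c *\<^sub>C y)" for N
        by (simp add: cesaro_mean2_def cesaro_mean_def powC inner_scaleC_left)
      then show "((\<lambda>N. cesaro_mean2 T N (c *\<^sub>C x) y) \<longlongrightarrow> b x (cnj c *\<^sub>C y)) F"
        by (simp add: b)
    qed
    show "b (T x) (T x) = b x x" for x
    proof (rule uniq)
      \<comment> \<open>The average of length one is the squared norm itself, so the upper bound on
        the averages yields the second premise of the shift lemma.\<close>
      have "(norm x)\<^sup>2 = cesaro_mean T (Suc 0) x x"
        by (simp add: cesaro_mean_def power2_norm_eq_inner)
      then have "(norm x)\<^sup>2 \<le> M * (norm x)\<^sup>2"
        using M[of 0 x] by simp
      then have "((\<lambda>N. cesaro_mean2 T N (T x) (T x) - cesaro_mean2 T N x x) \<longlongrightarrow> 0) F"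
        using cesaro_mean2_shift[OF M] tendsto_mono[OF F(2)] by blast
      from tendsto_add[OF this b[of x x]]
      show "((\<lambda>N. cesaro_mean2 T N (T x) (T x)) \<longlongrightarrow> b x x) F"
        by simp
    qed
    show "l \<le> b x x" if "\<forall>N. l \<le> cesaro_mean T (Suc N) x x" for x l
    proof (rule tendsto_lowerbound[OF b _ F(1)])
      \<comment> \<open>The bound starts at \<open>N = 1\<close>, since the empty average is
        0.\<close>
      have "\<forall>\<^sub>F N in sequentially. l \<le> cesaro_mean2 T N x x"
        unfolding eventually_sequentially cesaro_mean2_def
        using average_ge[OF spec[OF that]] by (intro exI[of _ 1]) auto
      then show "\<forall>\<^sub>F N in F. l \<le> cesaro_mean2 T N x x"
        using F(2) by (rule filter_leD[rotated])
    qed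
    show "b x x \<le> M * (norm x)\<^sup>2" for x
    proof (rule tendsto_upperbound[OF b _ F(1)])
      show "\<forall>\<^sub>F N in F. cesaro_mean2 T N x x \<le> M * (norm x)\<^sup>2"
        unfolding cesaro_mean2_def using M M0
        by (intro always_eventually allI average_le) auto
    qed
  qed
qed

section \<open>Definiteness of the invariant form and the similarity\<close>

theorem theorem1p1:
  fixes T K :: "'a::complex_hilbert_space \<Rightarrow> 'a" and m M :: real
  assumes "bounded_clinear T" and "bounded_clinear K"
    and "m > 0" and "M > 0"
    and "closed (range K)" and "finite_cdim (op_kernel K)"
    and "\<And>(N::nat) x. N \<ge> 1 \<Longrightarrow>
           m * (norm (K x))\<^sup>2 \<le> 1 / real N * (\<Sum>n = 0..N - 1. (norm ((T ^^ n) x))\<^sup>2)"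
    and "\<And>(N::nat) x. N \<ge> 1 \<Longrightarrow>
           1 / real N * (\<Sum>n = 0..N - 1. (norm ((T ^^ n) x))\<^sup>2) \<le> M * (norm x)\<^sup>2"
    and "\<And>\<mu>. eigenvalue T \<mu> \<Longrightarrow> cmod \<mu> = 1"
  shows "similar_to_isometry T"
proof -
  have blT: "bounded_linear T" and TC: "\<And>c x. T (c *\<^sub>C x) = c *\<^sub>C T x" and blK: "bounded_linear K"
    using assms(1,2) by (auto simp: bounded_clinear_def)
  have mean: "cesaro_mean T (Suc N) x x
      = 1 / real (Suc N) * (\<Sum>n = 0..Suc N - 1. (norm ((T ^^ n) x))\<^sup>2)" for N x
    by (simp add: cesaro_mean_def power2_norm_eq_inner atLeast0AtMost lessThan_Suc_atMost)
  have upper: "cesaro_mean T (Suc N) x x \<le> M * (norm x)\<^sup>2"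
    and lower: "m * (norm (K x))\<^sup>2 \<le> cesaro_mean T (Suc N) x x" for N x
    unfolding mean using assms(7,8)[of "Suc N" x] by simp_all
  obtain b where lin: "\<And>y. linear (\<lambda>x. b x y)" and sym: "\<And>x y. b x y = b y x"
    and bC: "\<And>c x y. b (c *\<^sub>C x) y = b x (cnj c *\<^sub>C y)"
    and bT: "\<And>x. b (T x) (T x) = b x x"
    and lb: "\<And>x l. \<forall>N. l \<le> cesaro_mean T (Suc N) x x \<Longrightarrow> l \<le> b x x"
    and ub: "\<And>x. b x x \<le> M * (norm x)\<^sup>2"
    by (rule cesaro_limit_form[OF assms(1) upper \<open>M > 0\<close>]) (rule that; assumption)
  have bK: "m * (norm (K x))\<^sup>2 \<le> b x x" for x
    using lower by (intro lb) blast
  have nonneg: "0 \<le> b x x" for x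
    using bK[of x] \<open>m > 0\<close> by (smt (verit) mult_nonneg_nonneg zero_le_power2)
  \<comment> \<open>By Cauchy-Schwarz a null vector is orthogonal to everything for
    \<open>b\<close>; this makes the null set \<open>E\<close> below a complex subspace.\<close>
  have null_right: "b x y = 0" if "b x x = 0" for x y
    using form_Cauchy_Schwarz[of b x y] lin sym nonneg that by simp
  have pos: "0 < b v v" if v0: "v \<noteq> 0" for v
  proof (rule ccontr)
    assume "\<not> 0 < b v v"
    then have v: "b v v = 0" using nonneg[of v] by simp
    define E where "E = {x. b x x = 0}"
    have EK: "E \<subseteq> op_kernel K"
      using bK \<open>m > 0\<close> by (auto simp: E_def op_kernel_def) (metis mult_le_0_iff norm_eq_zero not_less power2_less_eq_zero_iff)
    have ET: "T x \<in> E" if "x \<in> E" for x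
      using that bT by (simp add: E_def)
    have EC: "c *\<^sub>C x \<in> E" if "x \<in> E" for c x
      using that null_right by (simp add: E_def bC)
    have Eadd: "x + y \<in> E" if "x \<in> E" "y \<in> E" for x y
      using that null_right linear_add[OF lin] by (simp add: E_def)
    obtain B where B: "finite B" "complex_vector.span B = op_kernel K"
      using assms(6) by (auto simp: finite_cdim_def)
    have "(T ^^ n) v \<in> E" for n
      by (induction n) (use v ET in \<open>auto simp: E_def\<close>)
    then have "(T ^^ n) v \<in> complex_vector.span B" for n
      using EK B(2) by blast
    then obtain a p where w: "op_poly T p v \<noteq> 0" "T (op_poly T p v) = a *\<^sub>C op_poly T p v"
      using exists_eigenvector_op_poly[OF linear_simps(1)[OF blT] TC B(1) _ v0] by blast
    define w where "w = op_poly T p v"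
    have T0: "T 0 = 0" using linear_simps(3)[OF blT] .
    \<comment> \<open>Since \<open>E\<close> is an invariant subspace containing \<open>v\<close>,
      it contains every polynomial in \<open>T\<close> applied to \<open>v\<close>, in particular
      the eigenvector \<open>w\<close>.\<close>
    have "op_poly T s v \<in> E" for s
    proof (induction s)
      case 0
      show ?case using null_right[of 0] linear_0[OF lin] by (simp add: E_def)
    next
      case (pCons c s)
      then show ?case using v by (simp add: T0) (intro Eadd EC ET, auto simp: E_def)
    qed
    then have "b w w = 0" by (simp add: w_def E_def)
    have "cmod a = 1"
      using assms(9)[of a] w by (auto simp: eigenvalue_def)
    have "norm ((T ^^ n) w) = norm w" for n
    proof -
      have "(T ^^ n) w = a ^ n *\<^sub>C w"
        by (induction n) (use w(2) in \<open>simp_all add: TC scaleC_scaleC scaleC_one w_def mult.commute\<close>)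
      then show ?thesis by (simp add: norm_scaleC norm_power \<open>cmod a = 1\<close>)
    qed
    \<comment> \<open>The orbit of \<open>w\<close> has constant norm, so each average equals the
      squared norm of \<open>w\<close>, and the limit form cannot vanish on
      \<open>w\<close>.\<close>
    then have "(norm w)\<^sup>2 \<le> cesaro_mean T (Suc N) w w" for N
      by (simp add: mean)
    then have "(norm w)\<^sup>2 \<le> b w w" by (intro lb) blast
    then show False using \<open>b w w = 0\<close> w(1) by (simp add: w_def)
  qed
  obtain c where c: "c > 0" "\<And>x. c * (norm x)\<^sup>2 \<le> b x x"
    using form_coercive[OF lin sym pos ub blK assms(5)
        finite_cdim_compact_Int_cball[OF assms(6)] \<open>m > 0\<close> bK] by blast
  obtain A A' :: "'a \<Rightarrow> 'a" where A: "bounded_clinear A" "bounded_clinear A'"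
    "A \<circ> A' = id" "A' \<circ> A = id" "\<And>x. (norm (A x))\<^sup>2 = b x x"
    by (rule form_square_root[OF lin sym bC c ub \<open>M > 0\<close>]) (rule that; assumption)
  have AA': "A (A' x) = x" for x
    using A(3) by (metis comp_apply id_apply)
  \<comment> \<open>\<open>A\<close> carries the form \<open>b\<close> to the original inner
    product, so the invariance of \<open>b\<close> under \<open>T\<close> becomes isometry of the
    conjugate. The similarity is L = A', with inverse \<open>A\<close>.\<close>
  have "norm ((A \<circ> T \<circ> A') x) = norm x" for x
  proof -
    have "(norm ((A \<circ> T \<circ> A') x))\<^sup>2 = (norm x)\<^sup>2"
      using A(5)[of "T (A' x)"] A(5)[of "A' x"] by (simp add: bT AA')
    then show ?thesis by simp
  qed
  then show ?thesis
    unfolding similar_to_isometry_def using A(1-4) by blast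
qed

end
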